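(* Let $x_1,\dots,x_n\in\mathbb{R}^{d+1}$ be points with coordinates $x_i=(1,x_{i1},\dots,x_{id})$ and let $r\in\{1,\dots,n\}$. For every sufficiently large constant $M>0$ (depending on the data), an optimal parameter $\beta^*$ for the least $r$-quantile of squares fitting problem, i.e. a minimizer over $\beta=(\beta_0,\dots,\beta_{d-1})\in\mathbb{R}^d$ of $\varepsilon_{(r)}(\beta)^2$, where $\varepsilon_i(\beta)=|x_{id}-\sum_{k=1}^{d-1}\beta_kx_{ik}-\beta_0|$, can be obtained by solving the following problem (the $\beta$-component of any optimal solution is such a minimizer), in the variables $\beta\in\mathbb{R}^d$, $z,\theta\in\mathbb{R}^n_+$, $w\in\{0,1\}^{n\times n}$: $$\begin{aligned} \min\ & \theta_r\\ \text{s.t. } & z_i\le\theta_j+M(1-w_{ij}), && i,j=1,\dots,n,\\ & \textstyle\sum_{i=1}^n w_{ij}=1\ (j=1,\dots,n),\quad \sum_{j=1}^n w_{ij}=1\ (i=1,\dots,n),\\ & \theta_j\ge\theta_{j-1}, && j=2,\dots,n,\\ & z_i\ge\Big(x_{id}-\sum_{k=1}^{d-1}\beta_kx_{ik}-\beta_0\Big)^2, && i=1,\dots,n. \end{aligned}$$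
   Context: Residuals are vertical distances with respect to the last coordinate, with $\beta_d$ normalized to $1$. $\varepsilon_{(1)}(\beta)\le\dots\le\varepsilon_{(n)}(\beta)$ are the residuals $\varepsilon_1(\beta),\dots,\varepsilon_n(\beta)$ sorted in nondecreasing order. The least median of squares (LMS) method is the case $r=\lfloor n/2\rfloor+1$. *)

theory Defs
  imports Complex_Main "HOL-Library.FuncSet"
begin

(* A vector of real numbers indexed by a set I of naturals is an element of I \<rightarrow>\<^sub>E UNIV, so that
   R^d with coordinates 0, ..., d-1 is {0..<d} \<rightarrow>\<^sub>E UNIV. *)

definition signed_residual :: "nat \<Rightarrow> (nat \<Rightarrow> real) \<Rightarrow> (nat \<Rightarrow> real) \<Rightarrow> real" where
  "signed_residual d p \<beta> = p d - (\<Sum>k=1..<d. \<beta> k * p k) - \<beta> 0"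

definition residual :: "nat \<Rightarrow> (nat \<Rightarrow> real) \<Rightarrow> (nat \<Rightarrow> real) \<Rightarrow> real" where
  "residual d p \<beta> = \<bar>signed_residual d p \<beta>\<bar>"

(* Ranks are counted from 1, positions in a list from 0. *)
definition sorted_residual ::
  "nat \<Rightarrow> nat \<Rightarrow> (nat \<Rightarrow> nat \<Rightarrow> real) \<Rightarrow> nat \<Rightarrow> (nat \<Rightarrow> real) \<Rightarrow> real" where
  "sorted_residual d n x r \<beta> = sort (map (\<lambda>i. residual d (x i) \<beta>) [1..<Suc n]) ! (r - 1)"

definition least_quantile_minimizer ::
  "nat \<Rightarrow> nat \<Rightarrow> (nat \<Rightarrow> nat \<Rightarrow> real) \<Rightarrow> nat \<Rightarrow> (nat \<Rightarrow> real) \<Rightarrow> bool" where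
  "least_quantile_minimizer d n x r =
     is_arg_min (\<lambda>\<beta>. (sorted_residual d n x r \<beta>)\<^sup>2) (\<lambda>\<beta>. \<beta> \<in> {0..<d} \<rightarrow>\<^sub>E UNIV)"

type_synonym program_point =
  "(nat \<Rightarrow> real) \<times> (nat \<Rightarrow> real) \<times> (nat \<Rightarrow> real) \<times> (nat \<Rightarrow> nat \<Rightarrow> real)"

definition program_feasible ::
  "nat \<Rightarrow> nat \<Rightarrow> (nat \<Rightarrow> nat \<Rightarrow> real) \<Rightarrow> real \<Rightarrow> program_point \<Rightarrow> bool" where
  "program_feasible d n x M = (\<lambda>(\<beta>, z, \<theta>, w).
     \<beta> \<in> {0..<d} \<rightarrow>\<^sub>E UNIV \<and>
     z \<in> {1..n} \<rightarrow>\<^sub>E {0..} \<and>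
     \<theta> \<in> {1..n} \<rightarrow>\<^sub>E {0..} \<and>
     w \<in> {1..n} \<rightarrow>\<^sub>E ({1..n} \<rightarrow>\<^sub>E {0, 1}) \<and>
     (\<forall>i\<in>{1..n}. \<forall>j\<in>{1..n}. z i \<le> \<theta> j + M * (1 - w i j)) \<and>
     (\<forall>j\<in>{1..n}. (\<Sum>i=1..n. w i j) = 1) \<and>
     (\<forall>i\<in>{1..n}. (\<Sum>j=1..n. w i j) = 1) \<and>
     (\<forall>j\<in>{2..n}. \<theta> j \<ge> \<theta> (j - 1)) \<and>
     (\<forall>i\<in>{1..n}. z i \<ge> (signed_residual d (x i) \<beta>)\<^sup>2))"

definition program_optimal ::
  "nat \<Rightarrow> nat \<Rightarrow> (nat \<Rightarrow> nat \<Rightarrow> real) \<Rightarrow> nat \<Rightarrow> real \<Rightarrow> program_point \<Rightarrow> bool" where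
  "program_optimal d n x r M =
     is_arg_min (\<lambda>(\<beta>, z, \<theta>, w). \<theta> r) (program_feasible d n x M)"

end

theory Submission
  imports Defs "HOL-Library.Multiset" "HOL-Analysis.Elementary_Metric_Spaces"
begin

text \<open>
  A least-quantile minimizer \<open>\<beta>\<close> exists: the levels \<open>t\<close> for which some \<open>r\<close> residuals can
  simultaneously be made at most \<open>t\<close> form a finite union of projections of polyhedra, which are
  closed by Fourier--Motzkin elimination, so their infimum is attained. The constraints force
  \<open>w\<close> to be a permutation matrix, so the \<open>r\<close> points assigned to the first \<open>r\<close> columns have squared
  residuals at most \<open>\<theta> r\<close>, for any \<open>M\<close>. Conversely, once \<open>M\<close> exceeds all squared residuals at
  \<open>\<beta>\<close>, sorting them gives a feasible point attaining this bound. Hence both problems have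
  the same optimal value.
\<close>

section \<open>Fourier--Motzkin elimination with parametric right-hand sides\<close>

lemma finite_sets_separated:
  fixes A B :: "'a :: {no_top, no_bot, linorder} set"
  assumes "finite A" "finite B" "\<And>a b. a \<in> A \<Longrightarrow> b \<in> B \<Longrightarrow> a \<le> b"
  obtains s where "\<And>a. a \<in> A \<Longrightarrow> a \<le> s" "\<And>b. b \<in> B \<Longrightarrow> s \<le> b"
proof (cases "A = {}")
  case True
  show ?thesis
  proof (cases "B = {}")
    case False
    then show ?thesis
      using True assms(2) that[of "Min B"] by auto
  qed (use True that in auto)
next
  case False
  then show ?thesis
    using assms that[of "Max A"] by auto
qed

text \<open>A pair \<open>(c, f)\<close> encodes the inequality with coefficients \<open>c\<close>
  and right-hand side \<open>f t\<close>. Keeping the right-hand side as a function of the parameter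
  makes one elimination serve all \<open>t\<close> at once. The multipliers \<open>- c' m\<close>
  and \<open>c m\<close> are positive and cancel variable \<open>m\<close>.\<close>

definition eliminate_variable ::
  "nat \<Rightarrow> ((nat \<Rightarrow> real) \<times> ('a \<Rightarrow> real)) set \<Rightarrow> ((nat \<Rightarrow> real) \<times> ('a \<Rightarrow> real)) set" where
  "eliminate_variable m I = {(c, f) \<in> I. c m = 0} \<union>
     (\<lambda>((c, f), (c', f')). (\<lambda>k. c k * (- c' m) + c' k * c m, \<lambda>t. f t * (- c' m) + f' t * c m)) `
       ({(c, f) \<in> I. c m > 0} \<times> {(c, f) \<in> I. c m < 0})"

text \<open>Forward, the new inequalities are nonnegative combinations of the old ones. Backward,
  with the other variables fixed, each old inequality bounds variable \<open>m\<close> from one side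
  or does not involve it. The combined inequalities say that no lower bound exceeds an upper bound,
  so by finiteness a common value fits between them.\<close>

lemma fourier_motzkin_step:
  assumes fin: "finite I"
  shows "(\<exists>v. \<forall>(c, f)\<in>I. (\<Sum>k<Suc m. c k * v k) \<le> f t) \<longleftrightarrow>
         (\<exists>v. \<forall>(c, f)\<in>eliminate_variable m I. (\<Sum>k<m. c k * v k) \<le> f t)"
proof
  assume "\<exists>v. \<forall>(c, f)\<in>I. (\<Sum>k<Suc m. c k * v k) \<le> f t"
  then obtain v where v: "\<And>c f. (c, f) \<in> I \<Longrightarrow> (\<Sum>k<m. c k * v k) + c m * v m \<le> f t"
    by fastforce
  have "(\<Sum>k<m. (c k * (- c' m) + c' k * c m) * v k) \<le> f t * (- c' m) + f' t * c m"
    if c: "(c, f) \<in> I" "c m > 0" and c': "(c', f') \<in> I" "c' m < 0" for c f c' f'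
  proof -
    let ?s = "\<Sum>k<m. c k * v k" and ?s' = "\<Sum>k<m. c' k * v k"
    have "(?s + c m * v m) * (- c' m) + (?s' + c' m * v m) * c m \<le> f t * (- c' m) + f' t * c m"
      using v[OF c(1)] v[OF c'(1)] c(2) c'(2) by (intro add_mono mult_right_mono) auto
    moreover have "(\<Sum>k<m. (c k * (- c' m) + c' k * c m) * v k) = ?s * (- c' m) + ?s' * c m"
      unfolding sum_distrib_right sum.distrib[symmetric]
      by (intro sum.cong) (auto simp: algebra_simps)
    ultimately show ?thesis
      by (simp add: algebra_simps)
  qed
  moreover have "(\<Sum>k<m. c k * v k) \<le> f t" if "(c, f) \<in> I" "c m = 0" for c f
    using v[OF that(1)] that(2) by simp
  ultimately show "\<exists>v. \<forall>(c, f)\<in>eliminate_variable m I. (\<Sum>k<m. c k * v k) \<le> f t"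
    unfolding eliminate_variable_def by (intro exI[of _ v]) auto
next
  assume "\<exists>v. \<forall>(c, f)\<in>eliminate_variable m I. (\<Sum>k<m. c k * v k) \<le> f t"
  then obtain v where v: "\<And>c f. (c, f) \<in> eliminate_variable m I \<Longrightarrow> (\<Sum>k<m. c k * v k) \<le> f t"
    by auto
  \<comment> \<open>The bound that an inequality puts on variable \<open>m\<close> once the others
    are fixed by \<open>v\<close>: an upper bound if \<open>c m > 0\<close>, a lower bound if
    \<open>c m < 0\<close>.\<close>
  define g where "g = (\<lambda>(c, f). (f t - (\<Sum>k<m. c k * v k)) / c m)"
  have sep: "g (c', f') \<le> g (c, f)"
    if c: "(c, f) \<in> I" "c m > 0" and c': "(c', f') \<in> I" "c' m < 0" for c f c' f'
  proof -
    let ?s = "\<Sum>k<m. c k * v k" and ?s' = "\<Sum>k<m. c' k * v k"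
    have "(\<lambda>k. c k * (- c' m) + c' k * c m, \<lambda>t. f t * (- c' m) + f' t * c m)
        \<in> eliminate_variable m I"
      unfolding eliminate_variable_def using c c'
      by (intro UnI2 image_eqI[of _ _ "((c, f), (c', f'))"]) auto
    from v[OF this]
    have "(\<Sum>k<m. (c k * (- c' m) + c' k * c m) * v k) \<le> f t * (- c' m) + f' t * c m" .
    moreover have "(\<Sum>k<m. (c k * (- c' m) + c' k * c m) * v k) = ?s * (- c' m) + ?s' * c m"
      unfolding sum_distrib_right sum.distrib[symmetric]
      by (intro sum.cong) (auto simp: algebra_simps)
    ultimately have "(f' t - ?s') * c m \<ge> (f t - ?s) * c' m"
      by (simp add: algebra_simps)
    then show ?thesis
      using c(2) c'(2) unfolding g_def by (simp add: field_simps)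
  qed
  have fin': "finite (g ` {(c, f) \<in> I. P c f})" for P
    using fin by (intro finite_imageI) (auto elim!: finite_subset[rotated])
  obtain s where s: "\<And>a. a \<in> g ` {(c, f) \<in> I. c m < 0} \<Longrightarrow> a \<le> s"
      "\<And>b. b \<in> g ` {(c, f) \<in> I. c m > 0} \<Longrightarrow> s \<le> b"
  proof (rule finite_sets_separated[OF fin' fin'])
    show "a \<le> b"
      if "a \<in> g ` {(c, f) \<in> I. c m < 0}" "b \<in> g ` {(c, f) \<in> I. c m > 0}" for a b
      using that sep by (elim imageE) auto
  qed (rule that)
  have "(\<Sum>k<m. c k * v k) + c m * s \<le> f t" if c: "(c, f) \<in> I" for c f
  proof (cases "c m" "0 :: real" rule: linorder_cases)
    case less
    then have "g (c, f) \<le> s"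
      using s(1) c by force
    then show ?thesis
      using less by (simp add: g_def field_simps)
  next
    case equal
    then show ?thesis
      using v[of c f] c by (simp add: eliminate_variable_def)
  next
    case greater
    then have "s \<le> g (c, f)"
      using s(2) c by force
    then show ?thesis
      using greater by (simp add: g_def field_simps)
  qed
  then show "\<exists>v. \<forall>(c, f)\<in>I. (\<Sum>k<Suc m. c k * v k) \<le> f t"
    by (intro exI[of _ "v(m := s)"]) (auto simp: case_prod_beta)
qed

text \<open>Elimination preserves continuity of the right-hand sides. When no variable is left, the
  set is an intersection of closed sets of the form \<open>{t. 0 \<le> f t}\<close>.\<close>

lemma closed_feasible_right_hand_sides:
  fixes I :: "((nat \<Rightarrow> real) \<times> ('a :: topological_space \<Rightarrow> real)) set"
  assumes "finite I" "\<And>c f. (c, f) \<in> I \<Longrightarrow> continuous_on UNIV f"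
  shows "closed {t. \<exists>v. \<forall>(c, f)\<in>I. (\<Sum>k<m. c k * v k) \<le> f t}"
  using assms
proof (induction m arbitrary: I)
  case 0
  have "{t. \<exists>v :: nat \<Rightarrow> real. \<forall>(c, f)\<in>I. (\<Sum>k<0. c k * v k) \<le> f t} = (\<Inter>(c, f)\<in>I. {t. 0 \<le> f t})"
    by auto
  also have "closed \<dots>"
    using 0(2) by (intro closed_INT) (auto intro!: closed_Collect_le continuous_intros)
  finally show ?case .
next
  case (Suc m)
  have "closed {t. \<exists>v. \<forall>(c, f)\<in>eliminate_variable m I. (\<Sum>k<m. c k * v k) \<le> f t}"
  proof (rule Suc.IH)
    have "finite {(c, f) \<in> I. P c f}" for P
      by (rule finite_subset[OF _ Suc.prems(1)]) auto
    then show "finite (eliminate_variable m I)"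
      unfolding eliminate_variable_def by (intro finite_UnI finite_imageI finite_cartesian_product)
    show "continuous_on UNIV f" if "(c, f) \<in> eliminate_variable m I" for c f
      using that Suc.prems(2) unfolding eliminate_variable_def by (auto intro!: continuous_intros)
  qed
  then show ?case
    by (simp only: fourier_motzkin_step[OF Suc.prems(1)])
qed

section \<open>Residuals and their order statistics\<close>

lemma residual_nonneg: "0 \<le> residual d p \<beta>"
  by (simp add: residual_def)

lemma residual_power2: "(residual d p \<beta>)\<^sup>2 = (signed_residual d p \<beta>)\<^sup>2"
  by (simp add: residual_def)

lemma signed_residual_eq_linear:
  assumes "d \<ge> 1" "p 0 = 1"
  shows "signed_residual d p \<beta> = p d - (\<Sum>k<d. p k * \<beta> k)"
proof -
  have "{..<d} = insert 0 {1..<d}"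
    using assms(1) by auto
  then have "(\<Sum>k<d. p k * \<beta> k) = \<beta> 0 + (\<Sum>k=1..<d. p k * \<beta> k)"
    using assms(2) by simp
  then show ?thesis
    by (simp add: signed_residual_def mult.commute)
qed

text \<open>Elimination yields an arbitrary function, while parameters must be extensional on
  \<open>{0..<d}\<close>. Since \<open>d \<ge> 1\<close>, the intercept index 0 survives the
  restriction.\<close>

lemma residual_restrict:
  "d \<ge> 1 \<Longrightarrow> residual d p (restrict \<beta> {0..<d}) = residual d p \<beta>"
  by (simp add: residual_def signed_residual_def)

lemma sorting_permutation:
  obtains \<sigma> where "bij_betw \<sigma> {1..n} {1..n}"
    "\<And>j k. 1 \<le> j \<Longrightarrow> j \<le> k \<Longrightarrow> k \<le> n \<Longrightarrow> residual d (x (\<sigma> j)) \<beta> \<le> residual d (x (\<sigma> k)) \<beta>"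
    "\<And>j. j \<in> {1..n} \<Longrightarrow> sorted_residual d n x j \<beta> = residual d (x (\<sigma> j)) \<beta>"
proof -
  define f where "f = (\<lambda>i. residual d (x i) \<beta>)"
  define p where "p = sort_key f [1..<Suc n]"
  have len: "length p = n" and dist: "distinct p" and set: "set p = {1..n}"
    and sorted: "sorted (map f p)"
    by (auto simp: p_def simp del: upt_Suc)
  have "sort (map f [1..<Suc n]) = map f p"
    by (rule properties_for_sort) (use sorted in \<open>simp_all add: p_def del: upt_Suc\<close>)
  then have eq: "sorted_residual d n x j \<beta> = f (p ! (j - 1))" if "j \<in> {1..n}" for j
    using that len by (auto simp: sorted_residual_def f_def[symmetric])
  \<comment> \<open>Ranks start at 1 and list positions at 0, so the permutation is this shift
    followed by list lookup.\<close>
  have "bij_betw (\<lambda>j. j - 1) {1..n} {..<n}"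
    by (rule bij_betw_byWitness[where f' = Suc]) auto
  from bij_betw_trans[OF this bij_betw_nth[OF dist _ set[symmetric]]] len
  have "bij_betw (\<lambda>j. p ! (j - 1)) {1..n} {1..n}"
    by (simp add: o_def)
  moreover have "f (p ! (j - 1)) \<le> f (p ! (k - 1))" if "1 \<le> j" "j \<le> k" "k \<le> n" for j k
    using sorted_nth_mono[OF sorted, of "j - 1" "k - 1"] that len by simp
  ultimately show ?thesis
    using that[of "\<lambda>j. p ! (j - 1)"] eq by (simp add: f_def)
qed

lemma sorted_residual_nonneg: "r \<in> {1..n} \<Longrightarrow> 0 \<le> sorted_residual d n x r \<beta>"
  by (rule sorting_permutation[of n d x \<beta>]) (simp add: residual_nonneg)

text \<open>This replaces a condition on a rank by a finite disjunction over index sets, each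
  disjunct being a system of linear inequalities in the parameter.\<close>

lemma sorted_residual_le_iff:
  assumes r: "r \<in> {1..n}"
  shows "sorted_residual d n x r \<beta> \<le> t \<longleftrightarrow>
    (\<exists>S \<subseteq> {1..n}. card S = r \<and> (\<forall>i\<in>S. residual d (x i) \<beta> \<le> t))"
proof -
  obtain \<sigma> where bij: "bij_betw \<sigma> {1..n} {1..n}"
    and mono: "\<And>j k. 1 \<le> j \<Longrightarrow> j \<le> k \<Longrightarrow> k \<le> n \<Longrightarrow>
      residual d (x (\<sigma> j)) \<beta> \<le> residual d (x (\<sigma> k)) \<beta>"
    and eq: "\<And>j. j \<in> {1..n} \<Longrightarrow> sorted_residual d n x j \<beta> = residual d (x (\<sigma> j)) \<beta>"
    using sorting_permutation[of n d x \<beta>] by metis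
  show ?thesis
  proof
    assume le: "sorted_residual d n x r \<beta> \<le> t"
    have "card (\<sigma> ` {1..r}) = r"
      using bij r by (subst card_image) (auto simp: bij_betw_def intro: inj_on_subset)
    moreover have "\<sigma> ` {1..r} \<subseteq> {1..n}"
      using bij r by (auto simp: bij_betw_def)
    moreover have "residual d (x i) \<beta> \<le> t" if "i \<in> \<sigma> ` {1..r}" for i
      using that le mono[of _ r] eq[OF r] r by fastforce
    ultimately show "\<exists>S \<subseteq> {1..n}. card S = r \<and> (\<forall>i\<in>S. residual d (x i) \<beta> \<le> t)"
      by blast
  next
    assume "\<exists>S \<subseteq> {1..n}. card S = r \<and> (\<forall>i\<in>S. residual d (x i) \<beta> \<le> t)"
    then obtain S where S: "S \<subseteq> {1..n}" "card S = r" "\<And>i. i \<in> S \<Longrightarrow> residual d (x i) \<beta> \<le> t"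
      by blast
    \<comment> \<open>Pigeonhole: fewer than \<open>r\<close> indices have rank below
      \<open>r\<close>, so \<open>S\<close> contains an index of rank at least \<open>r\<close>. Its
      residual dominates the one of rank \<open>r\<close>.\<close>
    have "card (\<sigma> ` {1..<r}) < card S"
      using card_image_le[of "{1..<r}" \<sigma>] S(2) r by fastforce
    then have "\<not> S \<subseteq> \<sigma> ` {1..<r}"
      by (meson card_mono finite_imageI finite_atLeastLessThan not_le)
    then obtain i where i: "i \<in> S" "i \<notin> \<sigma> ` {1..<r}"
      by blast
    moreover have "i \<in> \<sigma> ` {1..n}"
      using i(1) S(1) bij by (auto simp: bij_betw_def)
    ultimately obtain j where "j \<in> {r..n}" "i = \<sigma> j"
      by (metis (no_types, lifting) atLeastAtMost_iff atLeastLessThan_iff image_iff not_le)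
    then show "sorted_residual d n x r \<beta> \<le> t"
      using mono[of r j] eq[OF r] S(3)[OF i(1)] r by simp
  qed
qed

section \<open>Existence of a least-quantile minimizer\<close>

lemma closed_chebyshev_levels:
  assumes "d \<ge> 1" "finite S" "\<And>i. i \<in> S \<Longrightarrow> x i 0 = 1"
  shows "closed {t. \<exists>\<beta>. \<forall>i\<in>S. residual d (x i) \<beta> \<le> t}"
proof -
  \<comment> \<open>Each bound on an absolute value splits into two linear inequalities. The
    coordinate \<open>x i 0 = 1\<close> serves as the coefficient of the intercept.\<close>
  define I where "I = (\<lambda>i. (x i, \<lambda>t. t + x i d)) ` S \<union> (\<lambda>i. (\<lambda>k. - x i k, \<lambda>t. t - x i d)) ` S"
  have "closed {t. \<exists>\<beta>. \<forall>(c, f)\<in>I. (\<Sum>k<d. c k * \<beta> k) \<le> f t}"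
    using assms(2) by (intro closed_feasible_right_hand_sides)
      (auto simp: I_def intro!: continuous_intros)
  moreover have "(\<forall>(c, f)\<in>I. (\<Sum>k<d. c k * \<beta> k) \<le> f t) \<longleftrightarrow>
      (\<forall>i\<in>S. residual d (x i) \<beta> \<le> t)" for \<beta> t
    using assms(1,3)
    by (force simp: I_def ball_Un residual_def signed_residual_eq_linear sum_negf abs_le_iff)
  ultimately show ?thesis
    by simp
qed

lemma least_quantile_minimizer_exists:
  assumes d: "d \<ge> 1" and x: "\<And>i. i \<in> {1..n} \<Longrightarrow> x i 0 = 1" and r: "r \<in> {1..n}"
  obtains \<beta> where "least_quantile_minimizer d n x r \<beta>"
proof -
  define T where "T = {t. \<exists>\<beta>. sorted_residual d n x r \<beta> \<le> t}"
  have "T = (\<Union>S\<in>{S. S \<subseteq> {1..n} \<and> card S = r}. {t. \<exists>\<beta>. \<forall>i\<in>S. residual d (x i) \<beta> \<le> t})"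
    unfolding T_def sorted_residual_le_iff[OF r] by blast
  also have "closed \<dots>"
    using d x by (intro closed_UN ballI closed_chebyshev_levels)
      (auto dest: finite_subset[OF _ finite_atLeastAtMost])
  finally have "closed T" .
  moreover have bdd: "bdd_below T"
    unfolding T_def using sorted_residual_nonneg[OF r]
    by (intro bdd_belowI[of _ 0]) (auto intro: order_trans)
  moreover have "T \<noteq> {}"
    by (auto simp: T_def)
  ultimately have "Inf T \<in> T"
    by (intro closed_contains_Inf)
  then obtain \<beta> where \<beta>: "sorted_residual d n x r \<beta> \<le> Inf T"
    by (auto simp: T_def)
  have res: "sorted_residual d n x r (restrict \<beta> {0..<d}) = sorted_residual d n x r \<beta>"
    by (simp add: sorted_residual_def residual_restrict[OF d])
  \<comment> \<open>Every attained value is itself a level in \<open>T\<close>, hence at least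
    \<open>Inf T\<close>.\<close>
  have "sorted_residual d n x r \<beta> \<le> sorted_residual d n x r \<gamma>" for \<gamma>
    using \<beta> cInf_lower[OF _ bdd, of "sorted_residual d n x r \<gamma>"] by (force simp: T_def)
  then have "least_quantile_minimizer d n x r (restrict \<beta> {0..<d})"
    unfolding least_quantile_minimizer_def is_arg_min_linorder res
    using sorted_residual_nonneg[OF r] by (auto intro!: power_mono)
  then show ?thesis
    by (rule that)
qed

section \<open>Comparing the program with the order statistics\<close>

lemma sorted_residual_le_feasible:
  assumes feas: "program_feasible d n x M (\<beta>, z, \<theta>, w)" and r: "r \<in> {1..n}"
  shows "(sorted_residual d n x r \<beta>)\<^sup>2 \<le> \<theta> r"
proof -
  have w: "w i j = 0 \<or> w i j = 1" if "i \<in> {1..n}" "j \<in> {1..n}" for i j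
    using feas that by (auto simp: program_feasible_def PiE_iff)
  have zw: "z i \<le> \<theta> j + M * (1 - w i j)" if "i \<in> {1..n}" "j \<in> {1..n}" for i j
    using feas that by (auto simp: program_feasible_def)
  have col: "(\<Sum>i=1..n. w i j) = 1" if "j \<in> {1..n}" for j
    using feas that by (auto simp: program_feasible_def)
  have row: "(\<Sum>j=1..n. w i j) = 1" if "i \<in> {1..n}" for i
    using feas that by (auto simp: program_feasible_def)
  have res: "(residual d (x i) \<beta>)\<^sup>2 \<le> z i" if "i \<in> {1..n}" for i
    using feas that by (auto simp: program_feasible_def residual_power2)
  have succ: "\<theta> (j - 1) \<le> \<theta> j" if "j \<in> {2..n}" for j
    using feas that by (auto simp: program_feasible_def)
  have mono: "\<theta> j \<le> \<theta> k" if "1 \<le> j" "j \<le> k" "k \<le> n" for j k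
    using that(2,1,3)
  proof (induction k rule: dec_induct)
    case (step k)
    then show ?case
      using succ[of "Suc k"] by simp
  qed simp
  have nonneg: "0 \<le> \<theta> r"
    using feas r by (auto simp: program_feasible_def)
  \<comment> \<open>A column of zeros cannot sum to 1; \<open>\<tau>\<close> then picks a row
    holding a 1 in each column.\<close>
  have "\<exists>i\<in>{1..n}. w i j = 1" if j: "j \<in> {1..n}" for j
  proof (rule ccontr)
    assume "\<not> ?thesis"
    then have "(\<Sum>i=1..n. w i j) = 0"
      using w j by (intro sum.neutral) blast
    then show False
      using col[OF j] by simp
  qed
  then obtain \<tau> where \<tau>: "\<And>j. j \<in> {1..n} \<Longrightarrow> \<tau> j \<in> {1..n}" "\<And>j. j \<in> {1..n} \<Longrightarrow> w (\<tau> j) j = 1"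
    by metis
  \<comment> \<open>Two columns with their 1 in the same row would give a row sum of at least
    2.\<close>
  have "inj_on \<tau> {1..n}"
  proof (rule inj_onI, rule ccontr)
    fix j k
    assume jk: "j \<in> {1..n}" "k \<in> {1..n}" "\<tau> j = \<tau> k" "j \<noteq> k"
    have "(\<Sum>l\<in>{j, k}. w (\<tau> j) l) \<le> (\<Sum>l=1..n. w (\<tau> j) l)"
      using jk w[OF \<tau>(1)[OF jk(1)]] by (intro sum_mono2) fastforce+
    then show False
      using jk \<tau>(2)[OF jk(1)] \<tau>(2)[OF jk(2)] row[OF \<tau>(1)[OF jk(1)]] by simp
  qed
  then have "card (\<tau> ` {1..r}) = r"
    using r by (subst card_image) (auto intro: inj_on_subset)
  moreover have "\<tau> ` {1..r} \<subseteq> {1..n}"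
    using r by (intro image_subsetI \<tau>(1)) auto
  \<comment> \<open>At an entry 1 of \<open>w\<close> the term with \<open>M\<close> vanishes, so
    the squared residual is at most \<open>z (\<tau> j) \<le> \<theta> j \<le> \<theta> r\<close>.
    The root is taken because the counting criterion concerns unsquared residuals.\<close>
  moreover have "residual d (x (\<tau> j)) \<beta> \<le> sqrt (\<theta> r)" if j: "j \<in> {1..r}" for j
  proof (rule real_le_rsqrt)
    have j': "j \<in> {1..n}"
      using j r by auto
    show "(residual d (x (\<tau> j)) \<beta>)\<^sup>2 \<le> \<theta> r"
      using res[OF \<tau>(1)[OF j']] zw[OF \<tau>(1)[OF j'] j'] \<tau>(2)[OF j'] mono[of j r] j r by simp
  qed
  ultimately have "sorted_residual d n x r \<beta> \<le> sqrt (\<theta> r)"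
    unfolding sorted_residual_le_iff[OF r] by blast
  then have "(sorted_residual d n x r \<beta>)\<^sup>2 \<le> (sqrt (\<theta> r))\<^sup>2"
    using sorted_residual_nonneg[OF r] by (intro power_mono)
  then show ?thesis
    using nonneg by simp
qed

text \<open>Take \<open>z\<close> as the squared residuals, \<open>\<theta>\<close> as the same
  values in sorted order and \<open>w\<close> as the matrix of the sorting permutation. Where
  \<open>w\<close> is 1 the coupling constraint is an equality; where it is 0, it follows from
  \<open>z i \<le> M\<close> and \<open>0 \<le> \<theta> j\<close>.\<close>

lemma feasible_point_attaining_sorted_residual:
  assumes \<beta>: "\<beta> \<in> {0..<d} \<rightarrow>\<^sub>E UNIV" and r: "r \<in> {1..n}"
    and M: "\<And>i. i \<in> {1..n} \<Longrightarrow> (residual d (x i) \<beta>)\<^sup>2 \<le> M"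
  obtains z \<theta> w where "program_feasible d n x M (\<beta>, z, \<theta>, w)"
    "\<theta> r = (sorted_residual d n x r \<beta>)\<^sup>2"
proof -
  obtain \<sigma> where bij: "bij_betw \<sigma> {1..n} {1..n}"
    and mono: "\<And>j k. 1 \<le> j \<Longrightarrow> j \<le> k \<Longrightarrow> k \<le> n \<Longrightarrow>
      residual d (x (\<sigma> j)) \<beta> \<le> residual d (x (\<sigma> k)) \<beta>"
    and eq: "\<And>j. j \<in> {1..n} \<Longrightarrow> sorted_residual d n x j \<beta> = residual d (x (\<sigma> j)) \<beta>"
    using sorting_permutation[of n d x \<beta>] by metis
  have \<sigma>: "\<sigma> j \<in> {1..n}" if "j \<in> {1..n}" for j
    using bij that by (auto simp: bij_betw_def)
  define z where "z = (\<lambda>i\<in>{1..n}. (residual d (x i) \<beta>)\<^sup>2)"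
  define \<theta> where "\<theta> = (\<lambda>j\<in>{1..n}. (residual d (x (\<sigma> j)) \<beta>)\<^sup>2)"
  define w :: "nat \<Rightarrow> nat \<Rightarrow> real"
    where "w = (\<lambda>i\<in>{1..n}. \<lambda>j\<in>{1..n}. if i = \<sigma> j then 1 else 0)"
  have "(\<Sum>i=1..n. w i j) = 1" if "j \<in> {1..n}" for j
  proof -
    have "(\<Sum>i=1..n. w i j) = (\<Sum>i=1..n. if i = \<sigma> j then 1 else 0)"
      using that by (intro sum.cong) (auto simp: w_def)
    then show ?thesis
      using \<sigma>[OF that] by simp
  qed
  moreover have "(\<Sum>j=1..n. w i j) = 1" if "i \<in> {1..n}" for i
  proof -
    have "(\<Sum>j=1..n. w i j) = (\<Sum>j=1..n. if i = \<sigma> j then 1 else 0)"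
      using that by (intro sum.cong) (auto simp: w_def)
    also have "\<dots> = (\<Sum>k=1..n. if i = k then 1 else 0)"
      by (rule sum.reindex_bij_betw[OF bij])
    finally show ?thesis
      using that by simp
  qed
  moreover have "z i \<le> \<theta> j + M * (1 - w i j)" if "i \<in> {1..n}" "j \<in> {1..n}" for i j
    using M[OF that(1)] that by (auto simp: z_def \<theta>_def w_def intro: add_increasing)
  moreover have "\<theta> (j - 1) \<le> \<theta> j" if "j \<in> {2..n}" for j
    using mono[of "j - 1" j] that by (auto simp: \<theta>_def residual_nonneg intro!: power_mono)
  moreover have "z \<in> {1..n} \<rightarrow>\<^sub>E {0..}" "\<theta> \<in> {1..n} \<rightarrow>\<^sub>E {0..}"
      "w \<in> {1..n} \<rightarrow>\<^sub>E ({1..n} \<rightarrow>\<^sub>E {0, 1})"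
    by (auto simp: z_def \<theta>_def w_def)
  moreover have "z i \<ge> (signed_residual d (x i) \<beta>)\<^sup>2" if "i \<in> {1..n}" for i
    using that by (simp add: z_def residual_power2)
  ultimately have "program_feasible d n x M (\<beta>, z, \<theta>, w)"
    using \<beta> by (simp add: program_feasible_def)
  moreover have "\<theta> r = (sorted_residual d n x r \<beta>)\<^sup>2"
    using r by (simp add: \<theta>_def eq)
  ultimately show ?thesis
    by (rule that)
qed

theorem theorem13:
  fixes d n r :: nat and x :: "nat \<Rightarrow> nat \<Rightarrow> real"
  assumes "d \<ge> 1"
    and "\<forall>i\<in>{1..n}. x i \<in> {0..d} \<rightarrow>\<^sub>E UNIV \<and> x i 0 = 1"
    and "r \<in> {1..n}"
  shows "\<exists>M\<^sub>0>0. \<forall>M\<ge>M\<^sub>0.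
           (\<exists>\<beta> z \<theta> w. program_optimal d n x r M (\<beta>, z, \<theta>, w)) \<and>
           (\<forall>\<beta> z \<theta> w. program_optimal d n x r M (\<beta>, z, \<theta>, w) \<longrightarrow>
              least_quantile_minimizer d n x r \<beta>)"
proof -
  let ?v = "\<lambda>\<beta>. (sorted_residual d n x r \<beta>)\<^sup>2"
  obtain b where b: "least_quantile_minimizer d n x r b"
    using least_quantile_minimizer_exists[of d n x r] assms by blast
  then have b_mem: "b \<in> {0..<d} \<rightarrow>\<^sub>E UNIV"
    and b_min: "\<And>\<gamma>. \<gamma> \<in> {0..<d} \<rightarrow>\<^sub>E UNIV \<Longrightarrow> ?v b \<le> ?v \<gamma>"
    by (auto simp: least_quantile_minimizer_def is_arg_min_linorder)
  \<comment> \<open>Only the residuals at the fixed minimizer \<open>b\<close> have to be dominated.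
    The sum bounds each of its nonnegative terms, and the summand 1 makes the constant
    positive.\<close>
  define M\<^sub>0 where "M\<^sub>0 = 1 + (\<Sum>i=1..n. (residual d (x i) b)\<^sup>2)"
  have "M\<^sub>0 > 0"
    unfolding M\<^sub>0_def by (intro add_pos_nonneg sum_nonneg) auto
  moreover have "(\<exists>\<beta> z \<theta> w. program_optimal d n x r M (\<beta>, z, \<theta>, w)) \<and>
      (\<forall>\<beta> z \<theta> w. program_optimal d n x r M (\<beta>, z, \<theta>, w) \<longrightarrow> least_quantile_minimizer d n x r \<beta>)"
    if M: "M \<ge> M\<^sub>0" for M
  proof -
    have "(residual d (x i) b)\<^sup>2 \<le> M" if "i \<in> {1..n}" for i
      using member_le_sum[of i "{1..n}" "\<lambda>i. (residual d (x i) b)\<^sup>2"] that M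
      by (simp add: M\<^sub>0_def)
    then obtain z \<theta> w where feas: "program_feasible d n x M (b, z, \<theta>, w)" and \<theta>: "\<theta> r = ?v b"
      using feasible_point_attaining_sorted_residual[OF b_mem assms(3)] by blast
    \<comment> \<open>Chaining the first two facts bounds the objective of every feasible point
      below by \<open>?v b\<close>, the value attained by the point just constructed.\<close>
    have lower: "?v b \<le> ?v \<beta>'" "?v \<beta>' \<le> \<theta>' r" "\<beta>' \<in> {0..<d} \<rightarrow>\<^sub>E UNIV"
      if "program_feasible d n x M (\<beta>', z', \<theta>', w')" for \<beta>' z' \<theta>' w'
      using that sorted_residual_le_feasible[OF that assms(3)] b_min
      by (auto simp: program_feasible_def)
    have "program_optimal d n x r M (b, z, \<theta>, w)"
      unfolding program_optimal_def is_arg_min_linorder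
      using feas order_trans[OF lower(1,2)] \<theta> by auto
    \<comment> \<open>Optimality gives \<open>\<theta>' r \<le> ?v b\<close>, which closes the
      chain: \<open>?v \<beta>'\<close> is squeezed to the minimum \<open>?v b\<close>.\<close>
    moreover have "least_quantile_minimizer d n x r \<beta>'"
      if "program_optimal d n x r M (\<beta>', z', \<theta>', w')" for \<beta>' z' \<theta>' w'
    proof -
      have feas': "program_feasible d n x M (\<beta>', z', \<theta>', w')" and "\<theta>' r \<le> ?v b"
        using that feas \<theta> by (force simp: program_optimal_def is_arg_min_linorder)+
      then show ?thesis
        unfolding least_quantile_minimizer_def is_arg_min_linorder
        using lower[OF feas'] b_min by (auto intro: order_trans)
    qed
    ultimately show ?thesis
      by blast
  qed
  ultimately show ?thesis
    by blast
qed

end
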